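(* Let $M:[0,\infty)\to[0,\infty)$ be a non-constant function satisfying condition (M) with constants $d_M\ge 2$ and $D_M>2$. Let $n\ge1$ be an integer and $d\mu_n(r)=r^{n-1}e^{-r^2/2}\,dr$ on $[0,\infty)$. For a continuous and piecewise $C^1$ function $u:[0,\infty)\to\mathbb{R}$ set $$\mathcal{K}=\int_0^\infty M(r|u(r)|)\,d\mu_n(r),\quad \mathcal{L}=\int_0^\infty M(|u(r)|)\,d\mu_n(r),\quad \mathcal{M}=\int_0^\infty M(|u'(r)|)\,d\mu_n(r).$$ Then $$\mathcal{K}\le (D_M/d_M)^{D_M/(D_M-2)}\,\mathcal{L}\le e^{D_M/2}\,\mathcal{L}$$ or $$\mathcal{K}\le\left(\frac12 D_M\mathcal{M}^{1/D_M}+\sqrt{\frac14D_M^2\mathcal{M}^{2/D_M}+(D_M+n-2)\mathcal{L}^{2/D_M}}\right)^{D_M}.$$ If additionally $D_M+n\ge e+2$ (which holds true whenever $n\ge3$), then $$\mathcal{K}\le\left(\frac12 D_M\mathcal{M}^{1/D_M}+\sqrt{\frac14D_M^2\mathcal{M}^{2/D_M}+(D_M+n-2)\mathcal{L}^{2/D_M}}\right)^{D_M}.$$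
   Context: Condition (M), for a function $M:[0,\infty)\to[0,\infty)$ and constants $d_M,D_M>0$: $M$ is nonconstant, $M(ar)\le a^{D_M}M(r)$ for all $r\ge0$, $a\ge1$, and $M(ar)\le a^{d_M}M(r)$ for all $r\ge0$, $a\in(0,1)$. Integrals of nonnegative functions take values in $[0,+\infty]$. Here $e$ is Euler's number. *)

theory Defs
  imports "HOL-Analysis.Analysis"
begin

text \<open>A function on \<open>[0,\<infinity>)\<close> is represented by a function on \<open>real\<close> whose values on the negative
  axis are arbitrary.\<close>

definition condition_M :: "(real \<Rightarrow> real) \<Rightarrow> real \<Rightarrow> real \<Rightarrow> bool" where
  "condition_M M d D \<longleftrightarrow>
     d > 0 \<and> D > 0 \<and>
     (\<forall>r\<ge>0. M r \<ge> 0) \<and>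
     \<not> M constant_on {0..} \<and>
     (\<forall>r\<ge>0. \<forall>a\<ge>1. M (a * r) \<le> a powr D * M r) \<and>
     (\<forall>r\<ge>0. \<forall>a\<in>{0<..<1}. M (a * r) \<le> a powr d * M r)"

text \<open>The quantification over \<open>b\<close> allows infinitely many break points, finitely many
  in every bounded interval. The one-sided limits of the derivative
  at break points are not required to exist.\<close>

definition piecewise_C1_halfline :: "(real \<Rightarrow> real) \<Rightarrow> bool" where
  "piecewise_C1_halfline u \<longleftrightarrow>
     continuous_on {0..} u \<and> (\<forall>b>0. u piecewise_C1_differentiable_on {0..b})"

definition mu :: "nat \<Rightarrow> real measure" where
  "mu n = density (restrict_space lborel {0..}) (\<lambda>r. ennreal (r ^ (n - 1) * exp (- (r\<^sup>2 / 2))))"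

definition calK :: "(real \<Rightarrow> real) \<Rightarrow> nat \<Rightarrow> (real \<Rightarrow> real) \<Rightarrow> ennreal" where
  "calK M n u = (\<integral>\<^sup>+ r. ennreal (M (r * \<bar>u r\<bar>)) \<partial>mu n)"

definition calL :: "(real \<Rightarrow> real) \<Rightarrow> nat \<Rightarrow> (real \<Rightarrow> real) \<Rightarrow> ennreal" where
  "calL M n u = (\<integral>\<^sup>+ r. ennreal (M \<bar>u r\<bar>) \<partial>mu n)"

text \<open>The values of \<open>deriv u\<close> at \<open>0\<close> and at break points are irrelevant, since these form a null set.\<close>

definition calM :: "(real \<Rightarrow> real) \<Rightarrow> nat \<Rightarrow> (real \<Rightarrow> real) \<Rightarrow> ennreal" where
  "calM M n u = (\<integral>\<^sup>+ r. ennreal (M \<bar>deriv u r\<bar>) \<partial>mu n)"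

text \<open>Powers on \<open>[0,\<infinity>]\<close> with \<open>\<infinity>\<^sup>p = \<infinity>\<close> and \<open>0\<^sup>p = 0\<close>; meant for exponents \<open>p > 0\<close> only.\<close>

definition epowr :: "ennreal \<Rightarrow> real \<Rightarrow> ennreal" where
  "epowr x p = (if x = top then top else ennreal (enn2real x powr p))"

definition esqrt :: "ennreal \<Rightarrow> ennreal" where
  "esqrt x = (if x = top then top else ennreal (sqrt (enn2real x)))"

definition hardy_bound :: "(real \<Rightarrow> real) \<Rightarrow> real \<Rightarrow> nat \<Rightarrow> (real \<Rightarrow> real) \<Rightarrow> ennreal" where
  "hardy_bound M D n u =
     epowr (ennreal (1/2 * D) * epowr (calM M n u) (1 / D) +
            esqrt (ennreal (1/4 * D\<^sup>2) * epowr (calM M n u) (2 / D) +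
                   ennreal (D + real n - 2) * epowr (calL M n u) (2 / D))) D"

end

theory Submission
  imports Defs
begin

text \<open>
  Write \<open>K\<close>, \<open>L\<close>, \<open>N\<close> for \<open>calK M n u\<close>, \<open>calL M n u\<close>, \<open>calM M n u\<close>. The starting point is integration by parts. Since
  \<open>r exp (- r\<^sup>2 / 2)\<close> is minus the derivative of \<open>exp (- r\<^sup>2 / 2)\<close>, and since condition (M) says
  \<open>M'(s) \<le> D M(s) / s\<close> in a weak sense, one obtains
  \<open>K \<le> (D + n - 2) A + D B\<close> with \<open>A = \<integral> M(r\<bar>u\<bar>) / r\<^sup>2 d\<mu>\<^sub>n\<close> and \<open>B = \<integral> M(r\<bar>u\<bar>) / (r\<bar>u\<bar>) \<bar>u'\<bar> d\<mu>\<^sub>n\<close>.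
  If \<open>A \<le> K\<^bsup>1-2/D\<^esup> L\<^bsup>2/D\<^esup>\<close> and \<open>B \<le> K\<^bsup>1-1/D\<^esup> N\<^bsup>1/D\<^esup>\<close>, this is a quadratic inequality for \<open>K\<^bsup>1/D\<^esup>\<close>,
  and solving it gives the asserted bound (\<open>le_root_boundI\<close>).

  For \<open>M(s) = s\<^bsup>D\<^esup>\<close> the two estimates are Hoelder's inequality, that is, Jensen's inequality for the
  concave power \<open>y\<^bsup>q/D\<^esup>\<close> with \<open>q = 2\<close> or \<open>q = 1\<close>. In general \<open>M\<close> scales with the exponent \<open>D\<close> in one
  direction and with \<open>d\<close> in the other, so the power is replaced by the function that is \<open>y\<^bsup>q/D\<^esup>\<close> for
  \<open>y \<le> 1\<close> and \<open>y\<^bsup>q/d\<^esup>\<close> for \<open>y \<ge> 1\<close>. It is not concave when \<open>d < D\<close>, because its slope jumps up at \<open>1\<close>; but the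
  tangent to \<open>y\<^bsup>q/D\<^esup>\<close> at a point \<open>x \<le> (d/D)\<^bsup>D/(D-q)\<^esup>\<close> is steep enough to stay above it
  (\<open>power_le_tangent_mixed_homogeneity\<close>). Jensen's argument takes the tangent at \<open>x = L/K\<close> (or
  \<open>x = N/K\<close>), so it works unless this ratio exceeds the threshold. If \<open>L/K\<close> does, that is the first
  alternative of the theorem; if \<open>N/K\<close> does, then \<open>K \<le> D\<^bsup>D\<^esup> N\<close>, which is at most the asserted
  bound. When \<open>D + n \<ge> e + 2\<close>, the first alternative implies the second because the bound is at least
  \<open>(D + n - 2)\<^bsup>D/2\<^esup> L\<close>.

  Two technical points shape the argument. The function \<open>M\<close> need not be differentiable, so integration by
  parts is replaced by a bound on the right Dini derivative of the boundary term
  (\<open>boundary_term_right_Dini\<close>) together with a monotonicity criterion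
  (\<open>right_Dini_nonpos_imp_le\<close>). And \<open>K\<close> may a priori be infinite, which would make the quadratic inequality
  void; hence everything is proved on \<open>(0,R)\<close>, where the discarded boundary term at \<open>R\<close> has the right sign,
  and then \<open>R\<close> tends to infinity.
\<close>

section \<open>Monotonicity from Dini derivatives\<close>

text \<open>If \<open>f b\<close> exceeded \<open>f c\<close> by more than \<open>\<epsilon> (b - c)\<close>, then the last point where \<open>f\<close> still lies below the line of
  slope \<open>\<epsilon>\<close> through \<open>(c, f c)\<close> would contradict the hypothesis at that point. The endpoint \<open>a\<close> is
  excluded from the hypothesis, so that intervals can be glued at exceptional points; it is reached by continuity.\<close>

lemma right_Dini_nonpos_imp_le_open:
  fixes f :: "real \<Rightarrow> real"
  assumes "a \<le> b" and cont: "continuous_on {a..b} f"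
    and Dini: "\<And>x \<epsilon>. x \<in> {a<..<b} \<Longrightarrow> 0 < \<epsilon> \<Longrightarrow>
                 eventually (\<lambda>y. f y - f x \<le> \<epsilon> * (y - x)) (at_right x)"
  shows "f b \<le> f a"
proof (cases "a = b")
  case False
  with \<open>a \<le> b\<close> have "a < b" by simp
  have slack: "f b \<le> f c + \<epsilon> * (b - c)" if c: "c \<in> {a<..<b}" and "0 < \<epsilon>" for c \<epsilon>
  proof -
    define k where "k = (\<lambda>y. f y - f c - \<epsilon> * (y - c))"
    define Z where "Z = {y \<in> {c..b}. k y \<le> 0}"
    have contk: "continuous_on {c..b} k"
      unfolding k_def using c by (intro continuous_intros continuous_on_subset[OF cont]) auto
    have "Z = {c..b} \<inter> k -` {..0}" by (auto simp: Z_def)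
    then have "closed Z"
      using continuous_closed_preimage[OF contk] by simp
    moreover have "c \<in> Z" using c by (auto simp: Z_def k_def)
    moreover have bdd: "bdd_above Z" by (auto simp: Z_def intro: bdd_aboveI[of _ b])
    ultimately have SupZ: "Sup Z \<in> Z" by (intro closed_contains_Sup) auto
    define z where "z = Sup Z"
    have z: "z \<in> {c..b}" "k z \<le> 0" using SupZ by (auto simp: Z_def z_def)
    have "z = b"
    proof (rule ccontr)
      assume "z \<noteq> b"
      with z c have zin: "z \<in> {a<..<b}" by auto
      have "eventually (\<lambda>y. y < b) (at_right z)"
        using zin by (intro eventually_at_right_less[THEN eventually_mono] order_tendstoD) (auto intro: tendsto_eq_intros)
      then have "eventually (\<lambda>y. f y - f z \<le> \<epsilon> * (y - z) \<and> y < b \<and> z < y) (at_right z)"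
        using Dini[OF zin \<open>0 < \<epsilon>\<close>] eventually_at_right_less[of z] by eventually_elim auto
      then obtain y where y: "f y - f z \<le> \<epsilon> * (y - z)" "y < b" "z < y"
        using eventually_happens'[OF trivial_limit_at_right_real] by blast
      have "k y \<le> 0" using y(1) z(2) by (simp add: k_def algebra_simps)
      then have "y \<in> Z" using y z by (auto simp: Z_def)
      then have "y \<le> z" unfolding z_def by (intro cSup_upper bdd)
      with y show False by simp
    qed
    with z show ?thesis by (simp add: k_def)
  qed
  have le: "f b \<le> f c" if c: "c \<in> {a<..<b}" for c
  proof (rule field_le_epsilon)
    fix e :: real assume "0 < e"
    then have "f b \<le> f c + e / (b - c) * (b - c)" using c by (intro slack) auto
    then show "f b \<le> f c + e" using c by simp
  qed
  have "(f \<longlongrightarrow> f a) (at_right a)"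
    using cont \<open>a < b\<close> by (simp add: continuous_on_Icc_at_rightD)
  moreover have "eventually (\<lambda>c. f b \<le> f c) (at_right a)"
    using eventually_at_right_real[OF \<open>a < b\<close>] by eventually_elim (rule le)
  ultimately show ?thesis
    by (intro tendsto_lowerbound) auto
qed simp

lemma right_Dini_nonpos_imp_le:
  fixes f :: "real \<Rightarrow> real"
  assumes "finite S" "a \<le> b" "continuous_on {a..b} f"
    and "\<And>x \<epsilon>. x \<in> {a<..<b} - S \<Longrightarrow> 0 < \<epsilon> \<Longrightarrow>
           eventually (\<lambda>y. f y - f x \<le> \<epsilon> * (y - x)) (at_right x)"
  shows "f b \<le> f a"
  using assms
proof (induction S arbitrary: a b)
  case empty
  show ?case
    using empty.prems(3) by (intro right_Dini_nonpos_imp_le_open[OF empty.prems(1,2)]) simp_all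
next
  case (insert s S)
  show ?case
  proof (cases "s \<in> {a<..<b}")
    case True
    have "f s \<le> f a"
    proof (rule insert.IH)
      show "eventually (\<lambda>y. f y - f x \<le> \<epsilon> * (y - x)) (at_right x)"
        if "x \<in> {a<..<s} - S" "0 < \<epsilon>" for x \<epsilon>
        using that True by (intro insert.prems(3)) auto
    qed (use True in \<open>auto intro: continuous_on_subset[OF insert.prems(2)]\<close>)
    moreover have "f b \<le> f s"
    proof (rule insert.IH)
      show "eventually (\<lambda>y. f y - f x \<le> \<epsilon> * (y - x)) (at_right x)"
        if "x \<in> {s<..<b} - S" "0 < \<epsilon>" for x \<epsilon>
        using that True by (intro insert.prems(3)) auto
    qed (use True in \<open>auto intro: continuous_on_subset[OF insert.prems(2)]\<close>)
    ultimately show ?thesis by simp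
  next
    case False
    show ?thesis
    proof (rule insert.IH)
      show "eventually (\<lambda>y. f y - f x \<le> \<epsilon> * (y - x)) (at_right x)"
        if "x \<in> {a<..<b} - S" "0 < \<epsilon>" for x \<epsilon>
        using that False by (intro insert.prems(3)) auto
    qed (use insert.prems in auto)
  qed
qed

section \<open>Functions satisfying condition (M)\<close>

context
  fixes M :: "real \<Rightarrow> real" and d D :: real
  assumes M: "condition_M M d D"
begin

lemma condition_M_nonneg: "0 \<le> r \<Longrightarrow> 0 \<le> M r"
  using M by (simp add: condition_M_def)

lemma condition_M_exponents_pos: "0 < d" "0 < D"
  using M by (auto simp: condition_M_def)

lemma condition_M_scale_up: "0 \<le> r \<Longrightarrow> 1 \<le> a \<Longrightarrow> M (a * r) \<le> a powr D * M r"
  using M by (simp add: condition_M_def)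

lemma condition_M_scale_down: "0 \<le> r \<Longrightarrow> 0 < a \<Longrightarrow> a \<le> 1 \<Longrightarrow> M (a * r) \<le> a powr d * M r"
  using M by (cases "a = 1") (auto simp: condition_M_def)

lemma condition_M_zero: "M 0 = 0"
proof -
  have "M 0 \<le> (1/2) powr d * M 0"
    using condition_M_scale_down[of 0 "1/2"] by simp
  moreover have "(1/2::real) powr d < 1"
    using condition_M_exponents_pos powr_less_mono2[of d "1/2" 1] by simp
  moreover have "0 \<le> M 0" by (simp add: condition_M_nonneg)
  ultimately show ?thesis
    by (smt (verit, best) mult_less_cancel_right2)
qed

lemma condition_M_mono:
  assumes "0 \<le> s" "s \<le> t" shows "M s \<le> M t"
proof (cases "s = 0")
  case True
  then show ?thesis using assms by (simp add: condition_M_zero condition_M_nonneg)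
next
  case False
  with assms have "0 < s" "0 < t" by auto
  then have "M s \<le> (s / t) powr d * M t"
    using condition_M_scale_down[of t "s / t"] assms by simp
  also have "\<dots> \<le> 1 * M t"
    using \<open>0 < s\<close> \<open>0 < t\<close> assms condition_M_exponents_pos
    by (intro mult_right_mono powr_le1 condition_M_nonneg) auto
  finally show ?thesis by simp
qed

text \<open>A zero of \<open>M\<close> at a positive point would spread to all of \<open>[0,\<infinity>)\<close>: to the left by monotonicity, to the
  right by the upper scaling bound. This is where \<open>M\<close> being nonconstant enters.\<close>

lemma condition_M_pos:
  assumes "0 < r" shows "0 < M r"
proof (rule ccontr)
  assume "\<not> 0 < M r"
  then have Mr: "M r = 0" using condition_M_nonneg[of r] assms by simp
  have "M s = 0" if "0 \<le> s" for s
  proof (cases "s \<le> r")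
    case True
    then show ?thesis using condition_M_mono[OF that True] condition_M_nonneg[OF that] Mr by simp
  next
    case False
    then show ?thesis
      using condition_M_scale_up[of r "s / r"] condition_M_nonneg[OF that] Mr assms by simp
  qed
  then have "M constant_on {0..}" by (auto simp: constant_on_def)
  with M show False by (simp add: condition_M_def)
qed

text \<open>The scaling bounds of condition (M) are upper bounds; applied to \<open>a s\<close> and the factor \<open>1/a\<close> they turn into
  lower bounds with the exponents exchanged.\<close>

lemma condition_M_scale_up_lower:
  assumes "0 \<le> s" "1 \<le> a" shows "a powr d * M s \<le> M (a * s)"
proof -
  have "M s \<le> (1 / a) powr d * M (a * s)"
    using condition_M_scale_down[of "a * s" "1 / a"] assms by simp
  then show ?thesis using assms by (simp add: powr_divide field_simps)
qed

lemma condition_M_scale_down_lower: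
  assumes "0 \<le> s" "0 \<le> a" "a \<le> 1" shows "a powr D * M s \<le> M (a * s)"
proof (cases "a = 0")
  case True
  then show ?thesis by (simp add: condition_M_zero)
next
  case False
  with assms have "0 < a" by simp
  have "M s \<le> (1 / a) powr D * M (a * s)"
    using condition_M_scale_up[of "a * s" "1 / a"] assms \<open>0 < a\<close> by simp
  then show ?thesis using \<open>0 < a\<close> by (simp add: powr_divide field_simps)
qed

lemma condition_M_exponents_le: "d \<le> D"
proof -
  have "2 powr d * M 1 \<le> 2 powr D * M 1"
    using condition_M_scale_up_lower[of 1 2] condition_M_scale_up[of 1 2] by simp
  then show ?thesis using condition_M_pos[of 1] by simp
qed

lemma condition_M_continuous_on: "continuous_on {0..} M"
  unfolding continuous_on_def
proof
  fix r :: real assume "r \<in> {0..}"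
  then consider "r = 0" | "0 < r" by fastforce
  then show "(M \<longlongrightarrow> M r) (at r within {0..})"
  proof cases
    case 1
    have "((\<lambda>t. t powr d * M 1) \<longlongrightarrow> 0 powr d * M 1) (at 0 within {0..})"
      using condition_M_exponents_pos
      by (intro tendsto_intros tendsto_powr' ) (auto simp: eventually_at_filter)
    then have "((\<lambda>t. t powr d * M 1) \<longlongrightarrow> 0) (at 0 within {0..})" by simp
    moreover have "eventually (\<lambda>t. t \<in> {0<..<1}) (at 0 within {0::real..})"
      by (auto simp: eventually_at dist_real_def intro!: exI[of _ 1])
    then have "eventually (\<lambda>t. norm (M t) \<le> t powr d * M 1) (at 0 within {0..})"
      by eventually_elim (use condition_M_scale_down[of 1] in \<open>auto simp: condition_M_nonneg\<close>)
    ultimately show ?thesis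
      unfolding 1 condition_M_zero by (rule Lim_null_comparison[rotated])
  next
    case 2
    have lim: "((\<lambda>t. (t / r) powr D) \<longlongrightarrow> (r / r) powr D) (at r within {0..})"
      using 2 by (intro tendsto_intros) auto
    have up: "((\<lambda>t. max 1 ((t / r) powr D) * M r) \<longlongrightarrow> max 1 ((r / r) powr D) * M r) (at r within {0..})"
      by (intro tendsto_intros tendsto_max lim)
    have low: "((\<lambda>t. min 1 ((t / r) powr D) * M r) \<longlongrightarrow> min 1 ((r / r) powr D) * M r) (at r within {0..})"
      by (intro tendsto_intros tendsto_min lim)
    have bounds: "min 1 ((t / r) powr D) * M r \<le> M t \<and> M t \<le> max 1 ((t / r) powr D) * M r"
      if "0 \<le> t" for t
    proof (cases "t \<le> r")
      case True
      have "(t / r) powr D \<le> 1" using True that 2 condition_M_exponents_pos by (intro powr_le1) auto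
      then show ?thesis
        using condition_M_scale_down_lower[of r "t / r"] condition_M_mono[OF that True] 2 that True
        by simp
    next
      case False
      have "1 \<le> (t / r) powr D" using False 2 condition_M_exponents_pos by (intro ge_one_powr_ge_zero) auto
      then show ?thesis
        using condition_M_scale_up[of r "t / r"] condition_M_mono[of r t] 2 that False
        by simp
    qed
    show ?thesis
    proof (rule tendsto_sandwich)
      show "eventually (\<lambda>t. min 1 ((t / r) powr D) * M r \<le> M t) (at r within {0..})"
        using bounds by (auto simp: eventually_at_filter)
      show "eventually (\<lambda>t. M t \<le> max 1 ((t / r) powr D) * M r) (at r within {0..})"
        using bounds by (auto simp: eventually_at_filter)
    qed (use up low 2 in auto)
  qed
qed

lemma condition_M_le_square:
  assumes "2 \<le> d" "0 \<le> s" "s \<le> 1" shows "M s \<le> s\<^sup>2 * M 1"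
proof (cases "s = 0")
  case False
  with assms have "0 < s" by simp
  then have "M s \<le> s powr d * M 1" using condition_M_scale_down[of 1 s] assms by simp
  also have "\<dots> \<le> s powr 2 * M 1"
    using \<open>0 < s\<close> assms by (intro mult_right_mono powr_mono' condition_M_nonneg) auto
  finally show ?thesis using \<open>0 < s\<close> by (simp add: powr_numeral)
qed (simp add: condition_M_zero)

text \<open>Division by zero yields \<open>0\<close>, and \<open>M s \<le> s\<^sup>2 M 1\<close> near \<open>0\<close> makes this the continuous value. Thus zeros of
  \<open>u\<close> are harmless in the integrand \<open>M(r\<bar>u\<bar>) / (r\<bar>u\<bar>) \<bar>u'\<bar>\<close>.\<close>

lemma condition_M_quotient_continuous_on:
  assumes "2 \<le> d" shows "continuous_on {0..} (\<lambda>s. M s / s)"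
  unfolding continuous_on_def
proof
  fix r :: real assume "r \<in> {0..}"
  then consider "r = 0" | "0 < r" by fastforce
  then show "((\<lambda>s. M s / s) \<longlongrightarrow> M r / r) (at r within {0..})"
  proof cases
    case 1
    have "((\<lambda>t. t * M 1) \<longlongrightarrow> 0) (at 0 within {0..})"
      by (auto intro!: tendsto_eq_intros)
    moreover have "eventually (\<lambda>t. t \<in> {0<..<1}) (at 0 within {0::real..})"
      by (auto simp: eventually_at dist_real_def intro!: exI[of _ 1])
    then have "eventually (\<lambda>t. norm (M t / t) \<le> t * M 1) (at 0 within {0..})"
      by eventually_elim
        (use condition_M_le_square[OF assms] in \<open>auto simp: condition_M_nonneg field_simps power2_eq_square\<close>)
    ultimately show ?thesis
      unfolding 1 by (simp add: Lim_null_comparison)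
  next
    case 2
    then show ?thesis
      using condition_M_continuous_on by (intro tendsto_intros) (auto simp: continuous_on_def)
  qed
qed

end

section \<open>Tangent lines and the quadratic inequality\<close>

text \<open>A concave power lies below its tangent at \<open>x\<close>; after scaling by \<open>x\<close> this is Young's inequality.\<close>

lemma powr_le_tangent:
  fixes x y p :: real
  assumes "0 < x" "0 \<le> y" "0 < p" "p < 1"
  shows "y powr p \<le> (1 - p) * x powr p + p * x powr (p - 1) * y"
proof (cases "y = 0")
  case False
  with assms have "0 < y" by simp
  have "(y / x) powr p \<le> p * (y / x) + (1 - p)"
    using Youngs_inequality_0[of p "1 - p" "y / x" 1] assms \<open>0 < y\<close> by simp
  then have "x powr p * (y / x) powr p \<le> x powr p * (p * (y / x) + (1 - p))"
    using assms by (intro mult_left_mono) auto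
  then show ?thesis using assms \<open>0 < y\<close>
    by (simp add: powr_divide powr_diff algebra_simps)
qed (use assms in auto)

text \<open>Here \<open>f\<close> and \<open>h\<close> stand for the values of \<open>M\<close> at two points with ratio \<open>t\<close>, and the two last hypotheses are the
  lower scaling bounds. With \<open>p = q/D\<close>, the right-hand side for \<open>h = y f\<close> is \<open>f\<close> times the tangent \<open>T\<close> at \<open>x\<close> to
  \<open>y\<^bsup>p\<^esup>\<close>; the bound for \<open>h\<close> has \<open>y = t\<^bsup>D\<^esup>\<close> or \<open>y = t\<^bsup>d\<^esup>\<close>, so \<open>t\<^bsup>q\<^esup>\<close> is \<open>y\<^bsup>p\<^esup>\<close> or \<open>y\<^bsup>q/d\<^esup>\<close>. For \<open>t \<le> 1\<close> concavity suffices. For \<open>t \<ge> 1\<close> one needs \<open>y\<^bsup>q/d\<^esup> \<le> T y\<close> on \<open>y \<ge> 1\<close>: it holds at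
  \<open>y = 1\<close>, and the slope of \<open>y\<^bsup>q/d\<^esup>\<close> there is at most \<open>q/d\<close>, which by the upper bound on \<open>x\<close> is at most the slope of \<open>T\<close>.\<close>

lemma power_le_tangent_mixed_homogeneity:
  fixes d D q x t f h :: real
  assumes q: "0 < q" "q \<le> d" "d \<le> D" "q < D"
    and x: "0 < x" "x \<le> (d / D) powr (D / (D - q))"
    and "0 \<le> t" "0 \<le> f"
    and small: "t \<le> 1 \<Longrightarrow> t powr D * f \<le> h"
    and large: "1 \<le> t \<Longrightarrow> t powr d * f \<le> h"
  shows "t powr q * f \<le> (1 - q / D) * x powr (q / D) * f + q / D * x powr (q / D - 1) * h"
proof -
  define p where "p = q / D"
  have p: "0 < p" "p < 1" using q by (auto simp: p_def)
  define T where "T = (\<lambda>y. (1 - p) * x powr p + p * x powr (p - 1) * y)"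
  have tangent: "y powr p \<le> T y" if "0 \<le> y" for y
    unfolding T_def using that p x by (intro powr_le_tangent) auto
  \<comment> \<open>At the largest admissible \<open>x\<close> the slope \<open>p x\<^bsup>p-1\<^esup>\<close> equals \<open>p D / d = q / d\<close>.\<close>
  have slope: "q / d \<le> p * x powr (p - 1)"
  proof -
    have "((d / D) powr (D / (D - q))) powr (p - 1) \<le> x powr (p - 1)"
      using x p by (intro powr_mono2') auto
    moreover have "D / (D - q) * (p - 1) = - 1" using q by (simp add: p_def field_simps)
    ultimately have "D / d \<le> x powr (p - 1)"
      using q by (simp add: powr_powr powr_minus_divide)
    then have "p * (D / d) \<le> p * x powr (p - 1)" using p by (intro mult_left_mono) auto
    then show ?thesis using q by (simp add: p_def)
  qed
  have reduce: ?thesis if "t powr q \<le> T y" "y * f \<le> h" for y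
  proof -
    have "t powr q * f \<le> T y * f" using that \<open>0 \<le> f\<close> by (intro mult_right_mono)
    also have "\<dots> = (1 - p) * x powr p * f + p * x powr (p - 1) * (y * f)"
      by (simp add: T_def algebra_simps)
    also have "\<dots> \<le> (1 - p) * x powr p * f + p * x powr (p - 1) * h"
      using that p by (intro add_left_mono mult_left_mono) auto
    finally show ?thesis by (simp add: p_def)
  qed
  show ?thesis
  proof (cases "t \<le> 1")
    case True
    have "t powr q = (t powr D) powr p" using q by (simp add: powr_powr p_def)
    then show ?thesis using tangent[of "t powr D"] small[OF True] reduce by simp
  next
    case False
    define y where "y = t powr d"
    have y: "1 \<le> y" using False q by (auto simp: y_def intro: ge_one_powr_ge_zero)
    have "t powr q = y powr (q / d)" using q by (simp add: powr_powr y_def)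
    also have "\<dots> \<le> 1 + q / d * (y - 1)"
      using Youngs_inequality_0[of "q / d" "1 - q / d" y 1] q y
      by (simp add: algebra_simps diff_divide_distrib)
    also have "\<dots> \<le> T 1 + p * x powr (p - 1) * (y - 1)"
      using tangent[of 1] slope y by (intro add_mono mult_right_mono) auto
    also have "\<dots> = T y" by (simp add: T_def algebra_simps)
    finally show ?thesis using large False y_def reduce by simp
  qed
qed

text \<open>The mixed tangent bound for \<open>q = 2\<close>, comparing the arguments \<open>r\<bar>v\<bar>\<close> and \<open>\<bar>v\<bar>\<close>, whose ratio is \<open>1/r\<close>.\<close>

lemma radial_tangent:
  assumes M: "condition_M M d D" and "2 \<le> d" "2 < D" "0 < r"
    and x: "0 < x" "x \<le> (d / D) powr (D / (D - 2))"
  shows "M (r * \<bar>v\<bar>) / r\<^sup>2 \<le> (1 - 2 / D) * x powr (2 / D) * M (r * \<bar>v\<bar>) + 2 / D * x powr (2 / D - 1) * M \<bar>v\<bar>"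
proof -
  have "(1 / r) powr 2 * M (r * \<bar>v\<bar>) \<le> (1 - 2 / D) * x powr (2 / D) * M (r * \<bar>v\<bar>) + 2 / D * x powr (2 / D - 1) * M \<bar>v\<bar>"
    using condition_M_exponents_le[OF M] assms
      condition_M_scale_down_lower[OF M, of "r * \<bar>v\<bar>" "1 / r"]
      condition_M_scale_up_lower[OF M, of "r * \<bar>v\<bar>" "1 / r"]
    by (intro power_le_tangent_mixed_homogeneity[where d = d] condition_M_nonneg[OF M]) auto
  then show ?thesis using \<open>0 < r\<close> by (simp add: powr_numeral power_divide)
qed

text \<open>The mixed tangent bound for \<open>q = 1\<close>, comparing the arguments \<open>s\<close> and \<open>\<bar>v\<bar>\<close>.\<close>

lemma gradient_tangent:
  assumes M: "condition_M M d D" and "2 \<le> d" "2 < D" "0 \<le> s"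
    and x: "0 < x" "x \<le> (d / D) powr (D / (D - 1))"
  shows "M s / s * \<bar>v\<bar> \<le> (1 - 1 / D) * x powr (1 / D) * M s + 1 / D * x powr (1 / D - 1) * M \<bar>v\<bar>"
proof (cases "s = 0")
  case True
  then show ?thesis using assms by (simp add: condition_M_zero[OF M] condition_M_nonneg[OF M])
next
  case False
  with assms have "0 < s" by simp
  have "(\<bar>v\<bar> / s) powr 1 * M s \<le> (1 - 1 / D) * x powr (1 / D) * M s + 1 / D * x powr (1 / D - 1) * M \<bar>v\<bar>"
    using condition_M_exponents_le[OF M] assms \<open>0 < s\<close>
      condition_M_scale_down_lower[OF M, of s "\<bar>v\<bar> / s"]
      condition_M_scale_up_lower[OF M, of s "\<bar>v\<bar> / s"]
    by (intro power_le_tangent_mixed_homogeneity[where d = d] condition_M_nonneg[OF M]) auto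
  then show ?thesis using \<open>0 < s\<close> by (simp add: field_simps)
qed

text \<open>The tangent at \<open>x = l/k\<close> gives the geometric mean exactly. If \<open>l = 0\<close>, this point is not
  positive and \<open>x\<close> tends to \<open>0\<close> instead.\<close>

lemma geometric_mean_from_tangents:
  fixes a k l p X :: real
  assumes "0 < p" "p < 1" "0 < k" "0 \<le> l" "0 < X" "l \<le> X * k"
    and tangent: "\<And>x. 0 < x \<Longrightarrow> x \<le> X \<Longrightarrow> a \<le> (1 - p) * x powr p * k + p * x powr (p - 1) * l"
  shows "a \<le> k powr (1 - p) * l powr p"
proof (cases "l = 0")
  case True
  have "((\<lambda>x. (1 - p) * x powr p * k) \<longlongrightarrow> (1 - p) * 0 powr p * k) (at_right 0)"
    using assms by (intro tendsto_intros tendsto_powr') (auto simp: eventually_at_filter)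
  moreover have "eventually (\<lambda>x. a \<le> (1 - p) * x powr p * k) (at_right 0)"
    using eventually_at_right_real[OF \<open>0 < X\<close>]
    by eventually_elim (use tangent True in auto)
  ultimately have "a \<le> (1 - p) * 0 powr p * k"
    by (intro tendsto_lowerbound) auto
  then show ?thesis using True assms by simp
next
  case False
  with assms have "0 < l" by simp
  then have "a \<le> (1 - p) * (l / k) powr p * k + p * (l / k) powr (p - 1) * l"
    using assms by (intro tangent) (auto simp: field_simps)
  also have "\<dots> = (l / k) powr p * k"
    using assms \<open>0 < l\<close> by (simp add: powr_diff field_simps)
  also have "\<dots> = k powr (1 - p) * l powr p"
    using assms \<open>0 < l\<close> by (simp add: powr_diff powr_divide field_simps)
  finally show ?thesis .
qed

text \<open>The right-hand side of the Hardy inequality for finite values \<open>l\<close> and \<open>m\<close> of the two integrals. Its \<open>D\<close>-th root is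
  the larger root of \<open>X\<^sup>2 = D m\<^bsup>1/D\<^esup> X + c l\<^bsup>2/D\<^esup>\<close>.\<close>

definition root_bound :: "real \<Rightarrow> real \<Rightarrow> real \<Rightarrow> real \<Rightarrow> real" where
  "root_bound D c l m =
     (1/2 * D * m powr (1 / D) + sqrt (1/4 * D\<^sup>2 * m powr (2 / D) + c * l powr (2 / D))) powr D"

lemma powr_two_div: "0 \<le> m \<Longrightarrow> m powr (2 / D) = (m powr (1 / D))\<^sup>2" for m D :: real
  by (metis (no_types, lifting) powr_ge_zero mult_2_right one_add_one powr_add add_divide_distrib power2_eq_square)

lemma le_root_bound_middle:
  assumes "0 < D" "0 \<le> c" "0 \<le> l" "0 \<le> m"
  shows "c powr (D / 2) * l \<le> root_bound D c l m"
proof -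
  have "sqrt (c * l powr (2 / D)) \<le> 1/2 * D * m powr (1 / D) + sqrt (1/4 * D\<^sup>2 * m powr (2 / D) + c * l powr (2 / D))"
    using assms by (intro add_increasing real_sqrt_le_mono) auto
  then have "sqrt (c * l powr (2 / D)) powr D \<le> root_bound D c l m"
    unfolding root_bound_def using assms by (intro powr_mono2) auto
  moreover have "sqrt (c * l powr (2 / D)) powr D = c powr (D / 2) * l"
    using assms by (simp add: powr_half_sqrt[symmetric] powr_powr powr_mult)
  ultimately show ?thesis by simp
qed

lemma le_root_bound_right:
  assumes "0 < D" "0 \<le> c" "0 \<le> l" "0 \<le> m"
  shows "D powr D * m \<le> root_bound D c l m"
proof -
  have "1/2 * D * m powr (1 / D) = sqrt (1/4 * D\<^sup>2 * m powr (2 / D))"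
    using assms by (simp add: powr_two_div real_sqrt_mult real_sqrt_divide)
  also have "\<dots> \<le> sqrt (1/4 * D\<^sup>2 * m powr (2 / D) + c * l powr (2 / D))"
    using assms by (intro real_sqrt_le_mono) auto
  finally have "(D * m powr (1 / D)) powr D \<le> root_bound D c l m"
    unfolding root_bound_def using assms by (intro powr_mono2) auto
  moreover have "(D * m powr (1 / D)) powr D = D powr D * m"
    using assms by (simp add: powr_powr powr_mult)
  ultimately show ?thesis by simp
qed

text \<open>Dividing the hypothesis by \<open>k / x\<^sup>2\<close>, where \<open>x = k\<^bsup>1/D\<^esup>\<close>, turns it into a quadratic inequality for \<open>x\<close>.\<close>

lemma le_root_boundI:
  assumes "0 < D" "0 \<le> c" "0 \<le> l" "0 \<le> m" "0 < k"
    and k: "k \<le> c * (k powr (1 - 2 / D) * l powr (2 / D)) + D * (k powr (1 - 1 / D) * m powr (1 / D))"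
  shows "k \<le> root_bound D c l m"
proof -
  define x where "x = k powr (1 / D)"
  define b where "b = D * m powr (1 / D)"
  define e where "e = c * l powr (2 / D)"
  have x: "0 < x" using assms by (simp add: x_def)
  have "k powr (1 - 2 / D) = k / x\<^sup>2" "k powr (1 - 1 / D) = k / x"
    using assms by (auto simp: powr_diff powr_two_div x_def)
  then have "k \<le> c * (k / x\<^sup>2 * l powr (2 / D)) + D * (k / x * m powr (1 / D))"
    using k by simp
  also have "\<dots> = k / x\<^sup>2 * (e + b * x)"
    using x by (simp add: e_def b_def field_simps power2_eq_square)
  finally have "k * x\<^sup>2 \<le> k / x\<^sup>2 * (e + b * x) * x\<^sup>2"
    by (intro mult_right_mono) auto
  also have "\<dots> = k * (e + b * x)" using x by simp
  finally have "x\<^sup>2 \<le> e + b * x" using \<open>0 < k\<close> by simp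
  then have "(x - b / 2)\<^sup>2 \<le> 1/4 * b\<^sup>2 + e"
    by (simp add: power2_diff power_divide field_simps)
  then have "x - b / 2 \<le> sqrt (1/4 * b\<^sup>2 + e)"
    by (rule real_le_rsqrt)
  then have "x \<le> 1/2 * D * m powr (1 / D) + sqrt (1/4 * D\<^sup>2 * m powr (2 / D) + c * l powr (2 / D))"
    using assms by (simp add: b_def e_def powr_two_div power_mult_distrib algebra_simps)
  then have "x powr D \<le> root_bound D c l m"
    unfolding root_bound_def using x assms by (intro powr_mono2) auto
  then show ?thesis using assms by (simp add: x_def powr_powr)
qed

text \<open>The tangent estimates may be used at \<open>l/k\<close> and \<open>m/k\<close> only below the thresholds \<open>X 2\<close> and \<open>X 1\<close>. A too
  large \<open>l\<close> is the first alternative. A too large \<open>m\<close> gives \<open>k \<le> D\<^bsup>D\<^esup> m\<close>, since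
  \<open>(D/d)\<^bsup>D/(D-1)\<^esup> \<le> D\<^bsup>D\<^esup>\<close>, and this is within the root bound.\<close>

lemma root_bound_alternative:
  fixes a b c d D k l m :: real
  assumes "2 \<le> d" "d \<le> D" "2 < D" "0 \<le> c" "0 \<le> l" "0 \<le> m" "0 \<le> k"
    and k: "k \<le> c * a + D * b"
    and a: "\<And>x. 0 < x \<Longrightarrow> x \<le> (d / D) powr (D / (D - 2)) \<Longrightarrow>
              a \<le> (1 - 2 / D) * x powr (2 / D) * k + 2 / D * x powr (2 / D - 1) * l"
    and b: "\<And>x. 0 < x \<Longrightarrow> x \<le> (d / D) powr (D / (D - 1)) \<Longrightarrow>
              b \<le> (1 - 1 / D) * x powr (1 / D) * k + 1 / D * x powr (1 / D - 1) * m"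
  shows "k \<le> (D / d) powr (D / (D - 2)) * l \<or> k \<le> root_bound D c l m"
proof -
  define X where "X = (\<lambda>q. (d / D) powr (D / (D - q)))"
  have X: "0 < X q" "(D / d) powr (D / (D - q)) = 1 / X q" for q
    using assms by (auto simp: X_def powr_divide)
  consider "k = 0" | "X 2 * k < l" | "0 < k" "l \<le> X 2 * k" "X 1 * k < m"
    | "0 < k" "l \<le> X 2 * k" "m \<le> X 1 * k"
    using assms by linarith
  then show ?thesis
  proof cases
    case 1
    then show ?thesis using assms by simp
  next
    case 2
    then have "k < 1 / X 2 * l" using X(1)[of 2] by (simp add: field_simps)
    then show ?thesis by (simp add: X(2))
  next
    case 3
    then have "k \<le> 1 / X 1 * m" using X(1)[of 1] by (simp add: field_simps)
    also have "\<dots> = (D / d) powr (D / (D - 1)) * m" by (simp add: X(2))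
    also have "\<dots> \<le> D powr D * m"
    proof (intro mult_right_mono)
      have "(D / d) powr (D / (D - 1)) \<le> D powr (D / (D - 1))"
        using assms by (intro powr_mono2) (auto simp: field_simps)
      also have "\<dots> \<le> D powr D"
        using assms by (intro powr_mono) (auto simp: field_simps)
      finally show "(D / d) powr (D / (D - 1)) \<le> D powr D" .
    qed fact
    also have "\<dots> \<le> root_bound D c l m"
      using assms by (intro le_root_bound_right) auto
    finally show ?thesis ..
  next
    case 4
    have "a \<le> k powr (1 - 2 / D) * l powr (2 / D)"
      using 4 assms X[of 2]
      by (intro geometric_mean_from_tangents[where X = "X 2"] a) (auto simp: X_def)
    moreover have "b \<le> k powr (1 - 1 / D) * m powr (1 / D)"
      using 4 assms X[of 1]
      by (intro geometric_mean_from_tangents[where X = "X 1"] b) (auto simp: X_def)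
    ultimately have "c * a + D * b \<le> c * (k powr (1 - 2 / D) * l powr (2 / D)) + D * (k powr (1 - 1 / D) * m powr (1 / D))"
      using assms by (intro add_mono mult_left_mono) auto
    with k have "k \<le> root_bound D c l m"
      using assms 4 by (intro le_root_boundI) auto
    then show ?thesis ..
  qed
qed

text \<open>The left-hand side grows as \<open>d\<close> decreases to \<open>2\<close>, and there \<open>D/2 \<le> exp (D/2 - 1)\<close> gives the bound.\<close>

lemma threshold_le_exp:
  fixes d D :: real
  assumes "2 \<le> d" "2 < D"
  shows "(D / d) powr (D / (D - 2)) \<le> exp (D / 2)"
proof -
  have "(D / d) powr (D / (D - 2)) \<le> (D / 2) powr (D / (D - 2))"
    using assms by (intro powr_mono2) (auto simp: field_simps)
  also have "\<dots> \<le> exp (D / 2 - 1) powr (D / (D - 2))"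
    using assms exp_ge_add_one_self[of "D / 2 - 1"] by (intro powr_mono2) auto
  also have "\<dots> = exp (D / 2)"
    using assms by (simp add: exp_powr_real field_simps)
  finally show ?thesis .
qed

section \<open>The boundary term\<close>

lemma eventually_at_right_increment_le:
  fixes f :: "real \<Rightarrow> real"
  assumes "(f has_real_derivative f') (at x)" "f' < c"
  shows "eventually (\<lambda>y. f y - f x \<le> c * (y - x)) (at_right x)"
proof -
  have "((\<lambda>y. (f y - f x) / (y - x)) \<longlongrightarrow> f') (at_right x)"
    using DERIV_subset[OF assms(1)] by (simp add: has_field_derivative_iff)
  then have "eventually (\<lambda>y. (f y - f x) / (y - x) < c) (at_right x)"
    using assms(2) by (rule order_tendstoD)
  then show ?thesis
    using eventually_at_right_less[of x] by eventually_elim (simp add: field_simps)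
qed

lemma eventually_at_right_increment_ge:
  fixes f :: "real \<Rightarrow> real"
  assumes "(f has_real_derivative f') (at x)" "c < f'"
  shows "eventually (\<lambda>y. c * (y - x) \<le> f y - f x) (at_right x)"
  using eventually_at_right_increment_le[OF DERIV_minus[OF assms(1)], of "- c"] assms(2)
  by (simp add: algebra_simps)

definition weight :: "nat \<Rightarrow> real \<Rightarrow> real" where
  "weight n r = r ^ (n - 1) * exp (- (r\<^sup>2 / 2))"

text \<open>This is \<open>M(r\<bar>u\<bar>) r\<^bsup>n-2\<^esup> exp (- r\<^sup>2 / 2)\<close>; the power \<open>r\<^bsup>n-2\<^esup>\<close> is split so that \<open>n = 1\<close> is covered. Division by
  zero gives it the value \<open>0\<close> at \<open>r = 0\<close>, where it is continuous.\<close>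

definition boundary_term :: "(real \<Rightarrow> real) \<Rightarrow> (real \<Rightarrow> real) \<Rightarrow> nat \<Rightarrow> real \<Rightarrow> real" where
  "boundary_term M u n r = M (r * \<bar>u r\<bar>) / r * weight n r"

text \<open>What the derivative of the boundary term would be if \<open>M'(s) = D M(s) / s\<close> held and \<open>\<bar>u\<bar>\<close> had derivative
  \<open>\<bar>u'\<bar>\<close>. Its last part is minus the integrand of \<open>calK\<close>.\<close>

definition boundary_rate ::
  "(real \<Rightarrow> real) \<Rightarrow> real \<Rightarrow> (real \<Rightarrow> real) \<Rightarrow> (real \<Rightarrow> real) \<Rightarrow> nat \<Rightarrow> real \<Rightarrow> real" where
  "boundary_rate M D u u' n r =
     ((D + real n - 2) * (M (r * \<bar>u r\<bar>) / r\<^sup>2) + D * (M (r * \<bar>u r\<bar>) / (r * \<bar>u r\<bar>) * \<bar>u' r\<bar>)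
        - M (r * \<bar>u r\<bar>)) * weight n r"

lemma weight_nonneg: "0 \<le> r \<Longrightarrow> 0 \<le> weight n r"
  by (simp add: weight_def)

lemma continuous_on_weight: "continuous_on A (weight n)"
  unfolding weight_def by (intro continuous_intros) auto

text \<open>Near \<open>x\<close> the boundary term is dominated by a smooth function \<open>\<Phi>\<close> that agrees with it at \<open>x\<close>. If
  \<open>u x \<noteq> 0\<close>, then \<open>y\<bar>u y\<bar>\<close> is at most a factor \<open>a \<ge> 1\<close>, smooth in \<open>y\<close>, times \<open>x\<bar>u x\<bar>\<close>, and condition (M) gives
  \<open>\<Phi>\<close> with \<open>a\<^bsup>D\<^esup>\<close>. If \<open>u x = 0\<close>, then \<open>y\<bar>u y\<bar>\<close> is of order \<open>y - x\<close>, and the quadratic decay of \<open>M\<close> at \<open>0\<close> makes the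
  derivative vanish.\<close>

lemma boundary_term_right_Dini:
  fixes M u :: "real \<Rightarrow> real"
  assumes M: "condition_M M d D" and "2 \<le> d" "1 \<le> n" "0 < x" "0 < \<epsilon>"
    and u: "(u has_real_derivative u' x) (at x)"
  shows "eventually (\<lambda>y. boundary_term M u n y - boundary_term M u n x
            \<le> (boundary_rate M D u u' n x + \<epsilon>) * (y - x)) (at_right x)"
proof -
  have D: "0 < D" using condition_M_exponents_pos[OF M] by simp
  obtain m where n: "n = Suc m" using \<open>1 \<le> n\<close> by (cases n) auto
  have increment: "eventually (\<lambda>y. \<bar>u y - u x\<bar> \<le> C * (y - x)) (at_right x)" if "\<bar>u' x\<bar> < C" for C
  proof -
    have "u' x < C" "- C < u' x" using that by auto
    from eventually_at_right_increment_le[OF u this(1)] eventually_at_right_increment_ge[OF u this(2)]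
    show ?thesis by eventually_elim (auto simp: abs_le_iff)
  qed
  show ?thesis
  proof (cases "u x = 0")
    case True
    define C where "C = \<bar>u' x\<bar> + 1"
    define \<Phi> where "\<Phi> = (\<lambda>y. (y * (C * (y - x)))\<^sup>2 * M 1 / y * weight n y)"
    have "(\<Phi> has_real_derivative 0) (at x)"
      unfolding \<Phi>_def weight_def using \<open>0 < x\<close> by (auto intro!: derivative_eq_intros)
    then have "eventually (\<lambda>y. \<Phi> y - \<Phi> x \<le> \<epsilon> * (y - x)) (at_right x)"
      using \<open>0 < \<epsilon>\<close> by (rule eventually_at_right_increment_le)
    moreover have "eventually (\<lambda>y. \<bar>u y - u x\<bar> \<le> C * (y - x)) (at_right x)"
      by (rule increment) (simp add: C_def)
    moreover have "((\<lambda>y. y * (C * (y - x))) \<longlongrightarrow> x * (C * (x - x))) (at_right x)"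
      by (intro tendsto_intros)
    then have "eventually (\<lambda>y. y * (C * (y - x)) < 1) (at_right x)"
      by (rule order_tendstoD) simp
    ultimately show ?thesis
      using eventually_at_right_less[of x]
    proof eventually_elim
      case (elim y)
      then have y: "0 < y" "x < y" using \<open>0 < x\<close> by auto
      have s: "y * \<bar>u y\<bar> \<le> y * (C * (y - x))"
        using elim True y by (intro mult_left_mono) auto
      then have "M (y * \<bar>u y\<bar>) \<le> M (y * (C * (y - x)))"
        using y by (intro condition_M_mono[OF M]) auto
      also have "\<dots> \<le> (y * (C * (y - x)))\<^sup>2 * M 1"
        using y elim by (intro condition_M_le_square[OF M \<open>2 \<le> d\<close>]) (auto simp: C_def)
      finally have "boundary_term M u n y \<le> \<Phi> y"
        unfolding boundary_term_def \<Phi>_def using y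
        by (intro mult_right_mono divide_right_mono weight_nonneg) auto
      then show ?case
        using elim True by (simp add: boundary_term_def boundary_rate_def \<Phi>_def condition_M_zero[OF M])
    qed
  next
    case False
    define U where "U = \<bar>u x\<bar>"
    have U: "0 < U" using False by (simp add: U_def)
    define E where "E = D * boundary_term M u n x / U + 1"
    \<comment> \<open>Replacing \<open>\<bar>u' x\<bar>\<close> by \<open>\<bar>u' x\<bar> + \<delta>\<close> raises the derivative of \<open>\<Phi>\<close> by \<open>\<delta> (E - 1)\<close>, which this choice keeps below \<open>\<epsilon>\<close>.\<close>
    define \<delta> where "\<delta> = \<epsilon> / (2 * E)"
    have bt: "0 \<le> boundary_term M u n x"
      using \<open>0 < x\<close> by (simp add: boundary_term_def weight_nonneg condition_M_nonneg[OF M])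
    then have den: "0 < E"
      using D U unfolding E_def by (intro add_nonneg_pos) auto
    have \<delta>: "0 < \<delta>" "\<delta> * (D * boundary_term M u n x / U) < \<epsilon>"
    proof -
      show "0 < \<delta>" using den \<open>0 < \<epsilon>\<close> by (simp add: \<delta>_def)
      then have "\<delta> * (D * boundary_term M u n x / U) \<le> \<delta> * E"
        by (intro mult_left_mono) (auto simp: E_def)
      also have "\<dots> = \<epsilon> / 2" using den by (simp add: \<delta>_def)
      also have "\<dots> < \<epsilon>" using \<open>0 < \<epsilon>\<close> by simp
      finally show "\<delta> * (D * boundary_term M u n x / U) < \<epsilon>" .
    qed
    define C where "C = \<bar>u' x\<bar> + \<delta>"
    define \<Phi> where "\<Phi> = (\<lambda>y. ((y / x) * (1 + C / U * (y - x))) powr D * M (x * U) / y * weight n y)"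
    define \<phi> where "\<phi> = boundary_rate M D u u' n x + \<delta> * (D * boundary_term M u n x / U)"
    have "(\<Phi> has_real_derivative \<phi>) (at x)"
      unfolding \<Phi>_def weight_def n using \<open>0 < x\<close> U
      apply (auto intro!: derivative_eq_intros)
      \<comment> \<open>The case distinction removes the truncated subtraction in the derivative of \<open>y ^ m\<close>.\<close>
      apply (cases m; simp add: \<phi>_def boundary_rate_def boundary_term_def weight_def n C_def
               U_def[symmetric] field_simps power2_eq_square)
      done
    then have "eventually (\<lambda>y. \<Phi> y - \<Phi> x \<le> (boundary_rate M D u u' n x + \<epsilon>) * (y - x)) (at_right x)"
      using \<delta> by (intro eventually_at_right_increment_le) (auto simp: \<phi>_def)
    moreover have "eventually (\<lambda>y. \<bar>u y - u x\<bar> \<le> C * (y - x)) (at_right x)"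
      using \<delta> by (intro increment) (simp add: C_def)
    ultimately show ?thesis
      using eventually_at_right_less[of x]
    proof eventually_elim
      case (elim y)
      then have y: "0 < y" "x < y" using \<open>0 < x\<close> by auto
      define a where "a = (y / x) * (1 + C / U * (y - x))"
      have C: "0 < C" using \<delta> by (simp add: C_def)
      have "1 * 1 \<le> a" unfolding a_def
        using y \<open>0 < x\<close> C U by (intro mult_mono) auto
      have "y * \<bar>u y\<bar> \<le> y * (U + C * (y - x))"
        using elim y by (intro mult_left_mono) (auto simp: U_def)
      also have "\<dots> = a * (x * U)"
        using U \<open>0 < x\<close> by (simp add: a_def field_simps)
      finally have "M (y * \<bar>u y\<bar>) \<le> M (a * (x * U))"
        using y by (intro condition_M_mono[OF M]) auto
      also have "\<dots> \<le> a powr D * M (x * U)"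
        using \<open>1 * 1 \<le> a\<close> \<open>0 < x\<close> U by (intro condition_M_scale_up[OF M]) auto
      finally have "boundary_term M u n y \<le> \<Phi> y"
        unfolding boundary_term_def \<Phi>_def a_def[symmetric] using y
        by (intro mult_right_mono divide_right_mono weight_nonneg) auto
      moreover have "\<Phi> x = boundary_term M u n x"
        using \<open>0 < x\<close> by (simp add: \<Phi>_def boundary_term_def U_def)
      ultimately show ?case using elim by simp
    qed
  qed
qed

lemma condition_M_continuous_on_compose:
  assumes M: "condition_M M d D" and u: "continuous_on A u" and "A \<subseteq> {0..}"
  shows "continuous_on A (\<lambda>r. M \<bar>u r\<bar>)" "continuous_on A (\<lambda>r. M (r * \<bar>u r\<bar>))"
  by (rule continuous_on_compose2[OF condition_M_continuous_on[OF M]];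
      use assms in \<open>auto intro!: continuous_intros\<close>)+

text \<open>The delicate point is \<open>0\<close>, in particular for \<open>n = 1\<close>: there \<open>M(r\<bar>u\<bar>) / r \<le> r M(\<bar>u\<bar>)\<close> because \<open>d \<ge> 2\<close>.\<close>

lemma continuous_on_boundary_term:
  assumes M: "condition_M M d D" and "2 \<le> d" "1 \<le> n" and u: "continuous_on {0..R} u"
  shows "continuous_on {0..R} (boundary_term M u n)"
  unfolding continuous_on_def
proof
  fix r assume r: "r \<in> {0..R}"
  have Mu: "((\<lambda>r. M \<bar>u r\<bar>) \<longlongrightarrow> M \<bar>u r\<bar>) (at r within {0..R})"
    and Mru: "((\<lambda>r. M (r * \<bar>u r\<bar>)) \<longlongrightarrow> M (r * \<bar>u r\<bar>)) (at r within {0..R})"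
    and w: "(weight n \<longlongrightarrow> weight n r) (at r within {0..R})"
    using condition_M_continuous_on_compose[OF M u] continuous_on_weight[of "{0..R}" n] r
    by (auto simp: continuous_on_def)
  show "(boundary_term M u n \<longlongrightarrow> boundary_term M u n r) (at r within {0..R})"
  proof (cases "r = 0")
    case False
    then show ?thesis unfolding boundary_term_def by (intro tendsto_intros Mru w)
  next
    case True
    have "((\<lambda>y. y * M \<bar>u y\<bar> * weight n y) \<longlongrightarrow> 0 * M \<bar>u r\<bar> * weight n r) (at r within {0..R})"
      unfolding True by (intro tendsto_intros Mu[unfolded True] w[unfolded True])
    moreover have "eventually (\<lambda>y. y \<in> {0<..<1}) (at r within {0..R})"
      using True by (auto simp: eventually_at dist_real_def intro!: exI[of _ 1])
    then have "eventually (\<lambda>y. norm (boundary_term M u n y) \<le> y * M \<bar>u y\<bar> * weight n y) (at r within {0..R})"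
    proof eventually_elim
      case (elim y)
      have "M (y * \<bar>u y\<bar>) \<le> y powr d * M \<bar>u y\<bar>"
        using elim by (intro condition_M_scale_down[OF M]) auto
      also have "\<dots> \<le> y powr 2 * M \<bar>u y\<bar>"
        using elim \<open>2 \<le> d\<close> by (intro mult_right_mono powr_mono' condition_M_nonneg[OF M]) auto
      also have "\<dots> = y * (y * M \<bar>u y\<bar>)"
        using elim by (simp add: powr_numeral power2_eq_square)
      finally have "M (y * \<bar>u y\<bar>) / y * weight n y \<le> y * M \<bar>u y\<bar> * weight n y"
        using elim by (intro mult_right_mono weight_nonneg) (auto simp: field_simps)
      then show ?case
        using elim by (simp add: boundary_term_def weight_nonneg condition_M_nonneg[OF M])
    qed
    ultimately show ?thesis
      unfolding True by (simp add: Lim_null_comparison boundary_term_def)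
  qed
qed

text \<open>The boundary term grows no faster than the integral of its rate. It vanishes at \<open>0\<close> and is nonnegative at
  \<open>R\<close>, so the integral is nonnegative. This replaces integration by parts. The derivative \<open>u'\<close>
  may be unbounded near the points of \<open>S\<close>, hence the separate integrability hypothesis.\<close>

lemma integral_boundary_rate_nonneg:
  assumes M: "condition_M M d D" and "2 \<le> d" "1 \<le> n" "0 < R"
    and u: "continuous_on {0..R} u" and S: "finite S"
    and u': "\<And>r. r \<in> {0<..<R} - S \<Longrightarrow> (u has_real_derivative u' r) (at r)"
    and rate_cont: "continuous_on ({0<..<R} - S) (boundary_rate M D u u' n)"
    and rate_int: "set_integrable lborel ({0<..<R} - S) (boundary_rate M D u u' n)"
  shows "0 \<le> (LINT r:{0<..<R} - S|lborel. boundary_rate M D u u' n r)"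
proof -
  let ?T = "{0<..<R} - S" and ?g = "boundary_rate M D u u' n"
  define G where "G = (\<lambda>x. integral {0..x} ?g)"
  have negl: "negligible {x \<in> ?T - {0..R}. ?g x \<noteq> 0}" "negligible {x \<in> {0..R} - ?T. ?g x \<noteq> 0}"
    using S by (auto intro!: negligible_finite finite_subset[of _ "insert 0 (insert R S)"] simp: subset_iff)
  have int: "?g integrable_on {0..R}"
    using set_borel_integral_eq_integral(1)[OF rate_int] negl by (rule integrable_spike_set)
  have G_deriv: "(G has_real_derivative ?g x) (at x)" if x: "x \<in> ?T" for x
  proof -
    have "open ?T" using S by (intro open_Diff finite_imp_closed) auto
    then have "isCont ?g x" using rate_cont x by (simp add: continuous_on_eq_continuous_at)
    then have "(G has_vector_derivative ?g x) (at x within {0..R} - {})"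
      unfolding G_def using x
      by (intro integral_has_vector_derivative_continuous_at int)
         (auto intro: continuous_at_imp_continuous_at_within)
    moreover have "at x within {0..R} = at x"
      using x by (intro at_within_interior) auto
    ultimately show ?thesis by (simp add: has_real_derivative_iff_has_vector_derivative)
  qed
  have "boundary_term M u n R - G R \<le> boundary_term M u n 0 - G 0"
  proof (rule right_Dini_nonpos_imp_le[where f = "\<lambda>x. boundary_term M u n x - G x", OF S])
    show "continuous_on {0..R} (\<lambda>x. boundary_term M u n x - G x)"
      unfolding G_def
      by (intro continuous_intros continuous_on_boundary_term[OF M \<open>2 \<le> d\<close> \<open>1 \<le> n\<close> u] indefinite_integral_continuous_1 int)
  next
    fix x \<epsilon> :: real assume x: "x \<in> ?T" and "0 < \<epsilon>"
    have "eventually (\<lambda>y. boundary_term M u n y - boundary_term M u n x \<le> (?g x + \<epsilon> / 2) * (y - x)) (at_right x)"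
      using x \<open>0 < \<epsilon>\<close> by (intro boundary_term_right_Dini[OF M \<open>2 \<le> d\<close> \<open>1 \<le> n\<close>] u') auto
    moreover have "eventually (\<lambda>y. (?g x - \<epsilon> / 2) * (y - x) \<le> G y - G x) (at_right x)"
      using \<open>0 < \<epsilon>\<close> by (intro eventually_at_right_increment_ge[OF G_deriv[OF x]]) auto
    ultimately show "eventually (\<lambda>y. boundary_term M u n y - G y - (boundary_term M u n x - G x) \<le> \<epsilon> * (y - x)) (at_right x)"
      by eventually_elim (simp add: field_simps)
  qed (use \<open>0 < R\<close> in auto)
  moreover have "0 \<le> boundary_term M u n R"
    using \<open>0 < R\<close> by (simp add: boundary_term_def weight_nonneg condition_M_nonneg[OF M])
  moreover have "boundary_term M u n 0 = 0" "G 0 = 0"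
    by (simp_all add: boundary_term_def G_def)
  moreover have "G R = (LINT r:?T|lborel. ?g r)"
    unfolding G_def set_borel_integral_eq_integral(2)[OF rate_int]
    using negl by (intro integral_spike_set) (auto simp: Diff_iff)
  ultimately show ?thesis by simp
qed

section \<open>The inequality on a bounded interval\<close>

lemma set_integral_le_combination:
  fixes F G H :: "real \<Rightarrow> real"
  assumes "set_integrable lborel T F" "set_integrable lborel T G" "set_integrable lborel T H"
    and "\<And>r. r \<in> T \<Longrightarrow> F r \<le> a * G r + b * H r"
  shows "(LINT r:T|lborel. F r) \<le> a * (LINT r:T|lborel. G r) + b * (LINT r:T|lborel. H r)"
proof -
  have "(LINT r:T|lborel. F r) \<le> (LINT r:T|lborel. a * G r + b * H r)"
    using assms by (intro set_integral_mono set_integral_add) auto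
  also have "\<dots> = a * (LINT r:T|lborel. G r) + b * (LINT r:T|lborel. H r)"
    using assms by (subst set_integral_add) auto
  finally show ?thesis .
qed

text \<open>The tangent bounds serve twice. At the threshold value of \<open>x\<close> they dominate the first two parts of the
  boundary rate by integrable functions; for general \<open>x\<close> their integrated forms feed \<open>root_bound_alternative\<close>. Upper bounds
  \<open>l\<close> and \<open>m\<close> in place of the integrals over \<open>(0,R)\<close> allow those to be the integrals over the whole half-line.\<close>

lemma truncated_hardy:
  assumes M: "condition_M M d D" and "2 \<le> d" "2 < D" "1 \<le> n" "0 < R"
    and u: "continuous_on {0..R} u" and S: "finite S"
    and u': "\<And>r. r \<in> {0<..<R} - S \<Longrightarrow> (u has_real_derivative u' r) (at r)"
    and u'_cont: "continuous_on ({0<..<R} - S) u'"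
    and grad_int: "set_integrable lborel ({0<..<R} - S) (\<lambda>r. M \<bar>u' r\<bar> * weight n r)"
    and l: "(LINT r:{0<..<R} - S|lborel. M \<bar>u r\<bar> * weight n r) \<le> l"
    and m: "(LINT r:{0<..<R} - S|lborel. M \<bar>u' r\<bar> * weight n r) \<le> m"
  defines "k \<equiv> (LINT r:{0<..<R} - S|lborel. M (r * \<bar>u r\<bar>) * weight n r)"
  shows "k \<le> (D / d) powr (D / (D - 2)) * l \<or> k \<le> root_bound D (D + real n - 2) l m"
proof -
  define T where "T = {0<..<R} - S"
  define fK where "fK = (\<lambda>r. M (r * \<bar>u r\<bar>) * weight n r)"
  define fL where "fL = (\<lambda>r. M \<bar>u r\<bar> * weight n r)"
  define fM where "fM = (\<lambda>r. M \<bar>u' r\<bar> * weight n r)"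
  define fA where "fA = (\<lambda>r. M (r * \<bar>u r\<bar>) / r\<^sup>2 * weight n r)"
  define fB where "fB = (\<lambda>r. M (r * \<bar>u r\<bar>) / (r * \<bar>u r\<bar>) * \<bar>u' r\<bar> * weight n r)"
  have T: "T \<in> sets borel" "T \<subseteq> {0..R}" "T \<subseteq> {0..}" and Tpos: "\<And>r. r \<in> T \<Longrightarrow> 0 < r"
    using S by (auto simp: T_def intro!: borel_open open_Diff finite_imp_closed)
  have uT: "continuous_on T u" using u T by (auto intro: continuous_on_subset)
  have contK: "continuous_on {0..R} fK" and contL: "continuous_on {0..R} fL"
    unfolding fK_def fL_def
    by (intro continuous_intros continuous_on_weight condition_M_continuous_on_compose[OF M u]; simp)+
  have intK: "set_integrable lborel T fK" and intL: "set_integrable lborel T fL"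
    using T contK contL by (auto intro!: set_integrable_subset[OF borel_integrable_atLeastAtMost'])
  have intM: "set_integrable lborel T fM" using grad_int by (simp add: fM_def T_def)
  have contA: "continuous_on T fA"
    unfolding fA_def using Tpos
    by (intro continuous_intros continuous_on_weight condition_M_continuous_on_compose[OF M uT T(3)]) auto
  have contB: "continuous_on T fB"
    unfolding fB_def using T u'_cont
    by (intro continuous_intros continuous_on_weight
          continuous_on_compose2[OF condition_M_quotient_continuous_on[OF M \<open>2 \<le> d\<close>], of T "\<lambda>r. r * \<bar>u r\<bar>"] uT)
       (auto simp: T_def)
  have Dd: "0 < d / D" "d / D \<le> 1" using condition_M_exponents_le[OF M] assms by auto
  have fA: "fA r \<le> (1 - 2 / D) * x powr (2 / D) * fK r + 2 / D * x powr (2 / D - 1) * fL r"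
    if "r \<in> T" "0 < x" "x \<le> (d / D) powr (D / (D - 2))" for r x
  proof -
    have "fA r \<le> ((1 - 2 / D) * x powr (2 / D) * M (r * \<bar>u r\<bar>) + 2 / D * x powr (2 / D - 1) * M \<bar>u r\<bar>) * weight n r"
      unfolding fA_def using that Tpos[of r] assms
      by (intro mult_right_mono radial_tangent[OF M] weight_nonneg) auto
    then show ?thesis by (simp add: fK_def fL_def algebra_simps)
  qed
  have fB: "fB r \<le> (1 - 1 / D) * x powr (1 / D) * fK r + 1 / D * x powr (1 / D - 1) * fM r"
    if "r \<in> T" "0 < x" "x \<le> (d / D) powr (D / (D - 1))" for r x
  proof -
    have "fB r \<le> ((1 - 1 / D) * x powr (1 / D) * M (r * \<bar>u r\<bar>) + 1 / D * x powr (1 / D - 1) * M \<bar>u' r\<bar>) * weight n r"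
      unfolding fB_def using that Tpos[of r] assms
      by (intro mult_right_mono gradient_tangent[OF M] weight_nonneg) auto
    then show ?thesis by (simp add: fK_def fM_def algebra_simps)
  qed
  have nonneg: "0 \<le> fA r" "0 \<le> fB r" "0 \<le> fK r" "0 \<le> fL r" "0 \<le> fM r" if "r \<in> T" for r
    using Tpos[OF that] by (auto simp: fA_def fB_def fK_def fL_def fM_def condition_M_nonneg[OF M] weight_nonneg)
  have intA: "set_integrable lborel T fA"
  proof (rule set_integrable_bound)
    define x where "x = (d / D) powr (D / (D - 2))"
    have x: "0 < x" "x \<le> (d / D) powr (D / (D - 2))" using Dd by (auto simp: x_def)
    show "set_integrable lborel T (\<lambda>r. (1 - 2 / D) * x powr (2 / D) * fK r + 2 / D * x powr (2 / D - 1) * fL r)"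
      using intK intL by (intro set_integral_add) auto
    show "AE r in lborel. r \<in> T \<longrightarrow> norm (fA r) \<le> norm ((1 - 2 / D) * x powr (2 / D) * fK r + 2 / D * x powr (2 / D - 1) * fL r)"
      using fA[of _ x] x nonneg by (intro AE_I2) (auto intro!: order_trans[OF _ abs_ge_self])
  qed (use set_measurable_continuous_on[OF T(1) contA] in \<open>simp add: set_borel_measurable_def\<close>)
  have intB: "set_integrable lborel T fB"
  proof (rule set_integrable_bound)
    define x where "x = (d / D) powr (D / (D - 1))"
    have x: "0 < x" "x \<le> (d / D) powr (D / (D - 1))" using Dd by (auto simp: x_def)
    show "set_integrable lborel T (\<lambda>r. (1 - 1 / D) * x powr (1 / D) * fK r + 1 / D * x powr (1 / D - 1) * fM r)"
      using intK intM by (intro set_integral_add) auto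
    show "AE r in lborel. r \<in> T \<longrightarrow> norm (fB r) \<le> norm ((1 - 1 / D) * x powr (1 / D) * fK r + 1 / D * x powr (1 / D - 1) * fM r)"
      using fB[of _ x] x nonneg by (intro AE_I2) (auto intro!: order_trans[OF _ abs_ge_self])
  qed (use set_measurable_continuous_on[OF T(1) contB] in \<open>simp add: set_borel_measurable_def\<close>)
  define a where "a = (LINT r:T|lborel. fA r)"
  define b where "b = (LINT r:T|lborel. fB r)"
  have rate: "boundary_rate M D u u' n = (\<lambda>r. (D + real n - 2) * fA r + D * fB r - fK r)"
    by (auto simp: boundary_rate_def fA_def fB_def fK_def algebra_simps)
  have "0 \<le> (LINT r:T|lborel. boundary_rate M D u u' n r)"
    unfolding T_def
  proof (rule integral_boundary_rate_nonneg[OF M \<open>2 \<le> d\<close> \<open>1 \<le> n\<close> \<open>0 < R\<close> u S u'])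
    show "continuous_on ({0<..<R} - S) (boundary_rate M D u u' n)"
      unfolding rate T_def[symmetric]
      using T by (intro continuous_intros contA contB continuous_on_subset[OF contK]) auto
    show "set_integrable lborel ({0<..<R} - S) (boundary_rate M D u u' n)"
      unfolding rate T_def[symmetric]
      using intA intB intK by (intro set_integral_add set_integral_diff) auto
  qed
  also have "(LINT r:T|lborel. boundary_rate M D u u' n r) = (D + real n - 2) * a + D * b - k"
    unfolding rate a_def b_def k_def T_def[symmetric] fK_def[symmetric]
    using intA intB intK by (simp add: set_integral_add set_integral_diff)
  finally have k_le: "k \<le> (D + real n - 2) * a + D * b" by simp
  have lint_nonneg: "0 \<le> (LINT r:T|lborel. f r)" if "\<And>r. r \<in> T \<Longrightarrow> 0 \<le> f r" for f :: "real \<Rightarrow> real"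
    unfolding set_lebesgue_integral_def using that
    by (intro integral_nonneg_AE) (auto simp: indicator_def)
  have k: "k = (LINT r:T|lborel. fK r)" by (simp add: k_def T_def fK_def)
  have l: "(LINT r:T|lborel. fL r) \<le> l" and m: "(LINT r:T|lborel. fM r) \<le> m"
    using l m by (simp_all add: T_def fL_def fM_def)
  show ?thesis
  proof (rule root_bound_alternative[OF \<open>2 \<le> d\<close> condition_M_exponents_le[OF M] \<open>2 < D\<close> _ _ _ _ k_le])
    fix x assume x: "0 < x" "x \<le> (d / D) powr (D / (D - 2))"
    have "a \<le> (1 - 2 / D) * x powr (2 / D) * k + 2 / D * x powr (2 / D - 1) * (LINT r:T|lborel. fL r)"
      unfolding a_def k using x by (intro set_integral_le_combination intA intK intL fA)
    also have "\<dots> \<le> (1 - 2 / D) * x powr (2 / D) * k + 2 / D * x powr (2 / D - 1) * l"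
      using \<open>2 < D\<close> l by (intro add_left_mono mult_left_mono) auto
    finally show "a \<le> (1 - 2 / D) * x powr (2 / D) * k + 2 / D * x powr (2 / D - 1) * l" .
  next
    fix x assume x: "0 < x" "x \<le> (d / D) powr (D / (D - 1))"
    have "b \<le> (1 - 1 / D) * x powr (1 / D) * k + 1 / D * x powr (1 / D - 1) * (LINT r:T|lborel. fM r)"
      unfolding b_def k using x by (intro set_integral_le_combination intB intK intM fB)
    also have "\<dots> \<le> (1 - 1 / D) * x powr (1 / D) * k + 1 / D * x powr (1 / D - 1) * m"
      using \<open>2 < D\<close> m by (intro add_left_mono mult_left_mono) auto
    finally show "b \<le> (1 - 1 / D) * x powr (1 / D) * k + 1 / D * x powr (1 / D - 1) * m" .
  qed (use \<open>2 < D\<close> lint_nonneg nonneg in \<open>auto simp: k intro: order_trans[OF _ l] order_trans[OF _ m]\<close>)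
qed

section \<open>Integration against the Gaussian weight\<close>

lemma weight_measurable [measurable]: "weight n \<in> borel_measurable borel"
  unfolding weight_def by measurable

lemma mu_eq: "mu n = density (restrict_space lborel {0..}) (\<lambda>r. ennreal (weight n r))"
  by (simp add: mu_def weight_def)

lemma sets_mu: "sets (mu n) = sets (restrict_space borel {0..})"
  by (simp add: mu_def sets_restrict_space)

lemma weight_measurable_halfline: "(\<lambda>r. ennreal (weight n r)) \<in> borel_measurable (restrict_space lborel {0..})"
  by (intro measurable_restrict_space1) measurable

lemma borel_measurable_mu:
  assumes "continuous_on {0..} f" shows "f \<in> borel_measurable (mu n)"
  using borel_measurable_continuous_on_restrict[OF assms]
  by (simp add: measurable_cong_sets[OF sets_mu refl])

lemma AE_mu_notin_finite:
  assumes "finite S" shows "AE r in mu n. 0 \<le> r \<and> r \<notin> S"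
proof -
  have "AE r in lborel. r \<notin> S"
    using assms by (intro AE_not_in finite_imp_null_set_lborel)
  then have "AE r in lborel. 0 \<le> r \<longrightarrow> 0 < weight n r \<longrightarrow> r \<notin> S"
    by (rule eventually_mono) simp
  then show ?thesis
    unfolding mu_eq using weight_measurable_halfline
    by (simp add: AE_density AE_restrict_space_iff)
qed

text \<open>The integrand is controlled on \<open>T\<close> only, which matters for \<open>deriv u\<close>: nothing is known about its values at
  break points.\<close>

lemma nn_integral_mu_indicator:
  fixes f :: "real \<Rightarrow> real"
  assumes T: "T \<in> sets borel" "T \<subseteq> {0..}" and f: "continuous_on T f"
  shows "(\<integral>\<^sup>+ r. ennreal (f r) * indicator T r \<partial>mu n)
          = (\<integral>\<^sup>+ r. ennreal (indicator T r *\<^sub>R (f r * weight n r)) \<partial>lborel)"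
proof -
  have "(\<lambda>r. indicator T r *\<^sub>R f r) \<in> borel_measurable borel"
    using T f by (intro borel_measurable_continuous_on_indicator) auto
  then have "(\<lambda>r. ennreal (indicator T r *\<^sub>R f r)) \<in> borel_measurable lborel" by measurable
  also have "(\<lambda>r. ennreal (indicator T r *\<^sub>R f r)) = (\<lambda>r. ennreal (f r) * indicator T r)"
    by (auto simp: indicator_def)
  finally have "(\<integral>\<^sup>+ r. ennreal (f r) * indicator T r \<partial>mu n)
      = (\<integral>\<^sup>+ r. ennreal (weight n r) * (ennreal (f r) * indicator T r) * indicator {0..} r \<partial>lborel)"
    unfolding mu_eq using weight_measurable_halfline
    by (simp add: nn_integral_density nn_integral_restrict_space measurable_restrict_space1)
  also have "\<dots> = (\<integral>\<^sup>+ r. ennreal (indicator T r *\<^sub>R (f r * weight n r)) \<partial>lborel)"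
    using T(2) weight_nonneg[of _ n]
    by (intro nn_integral_cong) (auto simp: indicator_def ennreal_mult'' mult.commute)
  finally show ?thesis .
qed

lemma nn_integral_mu_indicator_eq_LINT:
  fixes f :: "real \<Rightarrow> real"
  assumes T: "T \<in> sets borel" "T \<subseteq> {0..}" and f: "continuous_on T f" "\<And>r. r \<in> T \<Longrightarrow> 0 \<le> f r"
    and int: "set_integrable lborel T (\<lambda>r. f r * weight n r)"
  shows "(\<integral>\<^sup>+ r. ennreal (f r) * indicator T r \<partial>mu n) = ennreal (LINT r:T|lborel. f r * weight n r)"
  unfolding nn_integral_mu_indicator[OF T f(1)] set_lebesgue_integral_def
proof (rule nn_integral_eq_integral)
  show "integrable lborel (\<lambda>r. indicator T r *\<^sub>R (f r * weight n r))"
    using int by (simp add: set_integrable_def)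
  show "AE r in lborel. 0 \<le> indicator T r *\<^sub>R (f r * weight n r)"
    using f(2) T(2) weight_nonneg[of _ n] by (intro AE_I2) (auto simp: indicator_def subset_iff)
qed

lemma set_integrable_weight_if_finite_nn_integral_mu:
  fixes f :: "real \<Rightarrow> real"
  assumes T: "T \<in> sets borel" "T \<subseteq> {0..}" and f: "continuous_on T f" "\<And>r. r \<in> T \<Longrightarrow> 0 \<le> f r"
    and fin: "(\<integral>\<^sup>+ r. ennreal (f r) \<partial>mu n) < \<infinity>"
  shows "set_integrable lborel T (\<lambda>r. f r * weight n r)"
  unfolding set_integrable_def
proof (rule integrableI_nonneg)
  show "(\<lambda>r. indicator T r *\<^sub>R (f r * weight n r)) \<in> borel_measurable lborel"
    using borel_measurable_continuous_on_indicator[OF T(1), of "\<lambda>r. f r * weight n r"] f(1)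
    by (simp add: continuous_on_mult continuous_on_weight)
  show "AE r in lborel. 0 \<le> indicator T r *\<^sub>R (f r * weight n r)"
    using f(2) T(2) weight_nonneg[of _ n] by (intro AE_I2) (auto simp: indicator_def subset_iff)
  have "(\<integral>\<^sup>+ r. ennreal (f r) * indicator T r \<partial>mu n) \<le> (\<integral>\<^sup>+ r. ennreal (f r) \<partial>mu n)"
    by (intro nn_integral_mono) (auto simp: indicator_def)
  then show "(\<integral>\<^sup>+ r. ennreal (indicator T r *\<^sub>R (f r * weight n r)) \<partial>lborel) < \<infinity>"
    using fin unfolding nn_integral_mu_indicator[OF T f(1), symmetric] by simp
qed

lemma nn_integral_mu_le_if_truncations_le:
  assumes f: "f \<in> borel_measurable (mu n)"
    and le: "\<And>R. 0 < R \<Longrightarrow> (\<integral>\<^sup>+ r. f r * indicator {..<R} r \<partial>mu n) \<le> B"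
  shows "(\<integral>\<^sup>+ r. f r \<partial>mu n) \<le> B"
proof -
  have "f r = (SUP i. f r * indicator {..<real (Suc i)} r)" for r
  proof (rule antisym)
    obtain i :: nat where "r < i" using reals_Archimedean2 by blast
    then show "f r \<le> (SUP i. f r * indicator {..<real (Suc i)} r)"
      by (intro SUP_upper2[of i]) auto
  qed (auto intro!: SUP_least simp: indicator_def)
  then have "(\<integral>\<^sup>+ r. f r \<partial>mu n) = (\<integral>\<^sup>+ r. (SUP i. f r * indicator {..<real (Suc i)} r) \<partial>mu n)"
    by simp
  also have "\<dots> = (SUP i. \<integral>\<^sup>+ r. f r * indicator {..<real (Suc i)} r \<partial>mu n)"
  proof (rule nn_integral_monotone_convergence_SUP)
    show "incseq (\<lambda>i r. f r * indicator {..<real (Suc i)} r)"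
      by (auto simp: incseq_def le_fun_def indicator_def)
    show "(\<lambda>r. f r * indicator {..<real (Suc i)} r) \<in> borel_measurable (mu n)" for i
    proof -
      have "(\<lambda>r. indicator {..<real (Suc i)} r :: ennreal) \<in> borel_measurable (restrict_space borel {0..})"
        by (intro measurable_restrict_space1) measurable
      then have "(\<lambda>r. indicator {..<real (Suc i)} r :: ennreal) \<in> borel_measurable (mu n)"
        by (simp only: measurable_cong_sets[OF sets_mu refl])
      with f show ?thesis by (rule borel_measurable_times_ennreal)
    qed
  qed
  also have "\<dots> \<le> B" by (intro SUP_least le) simp
  finally show ?thesis .
qed

section \<open>The limit of large intervals\<close>

lemma hardy_bound_eq_root_bound:
  assumes "calM M n u < top" "calL M n u < top" "0 < D" "2 \<le> D + real n"
  shows "hardy_bound M D n u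
    = ennreal (root_bound D (D + real n - 2) (enn2real (calL M n u)) (enn2real (calM M n u)))"
proof -
  have "calM M n u \<noteq> top" "calL M n u \<noteq> top" using assms by auto
  then show ?thesis
    using assms unfolding hardy_bound_def epowr_def esqrt_def root_bound_def
    by (simp flip: ennreal_plus ennreal_mult)
qed

lemma hardy_bound_eq_top:
  assumes "calM M n u = top \<or> calL M n u = top" "0 < D" "2 < D + real n"
  shows "hardy_bound M D n u = top"
  using assms unfolding hardy_bound_def epowr_def esqrt_def
  by (auto simp: ennreal_mult_eq_top_iff)

text \<open>The interval is cut at \<open>R\<close> and the finitely many break points below \<open>R\<close>, a null set, are removed, so that the
  real-valued inequality applies with Lebesgue integrals over the open set \<open>T\<close>.\<close>

lemma calK_truncated_le:
  assumes M: "condition_M M d D" and "2 \<le> d" "2 < D" "1 \<le> n" "0 < R"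
    and u: "piecewise_C1_halfline u"
    and L: "calL M n u < top" and Mf: "calM M n u < top"
  defines "K \<equiv> (\<integral>\<^sup>+ r. ennreal (M (r * \<bar>u r\<bar>)) * indicator {..<R} r \<partial>mu n)"
  shows "K \<le> ennreal ((D / d) powr (D / (D - 2)) * enn2real (calL M n u))
    \<or> K \<le> ennreal (root_bound D (D + real n - 2) (enn2real (calL M n u)) (enn2real (calM M n u)))"
proof -
  obtain S v where S: "finite S"
    and v: "\<And>r. r \<in> {0..R} - S \<Longrightarrow> (u has_vector_derivative v r) (at r)"
    and v_cont: "continuous_on ({0..R} - S) v"
    using u \<open>0 < R\<close>
    unfolding piecewise_C1_halfline_def piecewise_C1_differentiable_on_def C1_differentiable_on_def
    by blast
  define T where "T = {0<..<R} - S"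
  have T: "T \<in> sets borel" "T \<subseteq> {0..}" "T \<subseteq> {0..R} - S" "T \<subseteq> {0..R}"
    using S by (auto simp: T_def intro!: borel_open open_Diff finite_imp_closed)
  have u': "(u has_real_derivative deriv u r) (at r)" "deriv u r = v r" if "r \<in> T" for r
  proof -
    have "(u has_real_derivative v r) (at r)"
      using v[of r] that T(3) by (auto simp: has_real_derivative_iff_has_vector_derivative)
    moreover from this show "deriv u r = v r" by (rule DERIV_imp_deriv)
    ultimately show "(u has_real_derivative deriv u r) (at r)" by simp
  qed
  have u'_cont: "continuous_on T (deriv u)"
    using continuous_on_subset[OF v_cont T(3)] u'(2) by (simp cong: continuous_on_cong)
  have uR: "continuous_on {0..R} u" and uT: "continuous_on T u"
    using u T(2) by (auto simp: piecewise_C1_halfline_def intro: continuous_on_subset)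
  note cont = condition_M_continuous_on_compose[OF M]
  have grad_int: "set_integrable lborel T (\<lambda>r. M \<bar>deriv u r\<bar> * weight n r)"
    using Mf by (intro set_integrable_weight_if_finite_nn_integral_mu T cont u'_cont)
      (auto simp: condition_M_nonneg[OF M] calM_def)
  have L_int: "set_integrable lborel T (\<lambda>r. M \<bar>u r\<bar> * weight n r)"
    using L by (intro set_integrable_weight_if_finite_nn_integral_mu T cont uT)
      (auto simp: condition_M_nonneg[OF M] calL_def)
  have "continuous_on {0..R} (\<lambda>r. M (r * \<bar>u r\<bar>) * weight n r)"
    by (intro continuous_intros cont uR continuous_on_weight) auto
  then have K_int: "set_integrable lborel T (\<lambda>r. M (r * \<bar>u r\<bar>) * weight n r)"
    using T by (intro set_integrable_subset[OF borel_integrable_atLeastAtMost']) auto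
  have le_whole: "(LINT r:T|lborel. M \<bar>f r\<bar> * weight n r) \<le> enn2real (\<integral>\<^sup>+ r. ennreal (M \<bar>f r\<bar>) \<partial>mu n)"
    if "continuous_on T f" "set_integrable lborel T (\<lambda>r. M \<bar>f r\<bar> * weight n r)"
      "(\<integral>\<^sup>+ r. ennreal (M \<bar>f r\<bar>) \<partial>mu n) < top" for f
  proof -
    have "ennreal (LINT r:T|lborel. M \<bar>f r\<bar> * weight n r)
        = (\<integral>\<^sup>+ r. ennreal (M \<bar>f r\<bar>) * indicator T r \<partial>mu n)"
      using that T by (intro nn_integral_mu_indicator_eq_LINT[symmetric] cont)
        (auto simp: condition_M_nonneg[OF M])
    also have "\<dots> \<le> (\<integral>\<^sup>+ r. ennreal (M \<bar>f r\<bar>) \<partial>mu n)"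
      by (intro nn_integral_mono) (auto simp: indicator_def)
    also have "\<dots> = ennreal (enn2real (\<integral>\<^sup>+ r. ennreal (M \<bar>f r\<bar>) \<partial>mu n))"
      using that(3) by simp
    finally show ?thesis by (simp add: ennreal_le_iff)
  qed
  have "K = (\<integral>\<^sup>+ r. ennreal (M (r * \<bar>u r\<bar>)) * indicator T r \<partial>mu n)"
    unfolding K_def
  proof (rule nn_integral_cong_AE)
    show "AE r in mu n. ennreal (M (r * \<bar>u r\<bar>)) * indicator {..<R} r = ennreal (M (r * \<bar>u r\<bar>)) * indicator T r"
      by (rule eventually_mono[OF AE_mu_notin_finite[of "insert 0 S" n]])
        (use S in \<open>auto simp: T_def indicator_def\<close>)
  qed
  also have "\<dots> = ennreal (LINT r:T|lborel. M (r * \<bar>u r\<bar>) * weight n r)"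
    using T by (intro nn_integral_mu_indicator_eq_LINT cont uT K_int) (auto simp: condition_M_nonneg[OF M])
  finally have K: "K = ennreal (LINT r:T|lborel. M (r * \<bar>u r\<bar>) * weight n r)" .
  have "(LINT r:T|lborel. M (r * \<bar>u r\<bar>) * weight n r)
          \<le> (D / d) powr (D / (D - 2)) * enn2real (calL M n u)
      \<or> (LINT r:T|lborel. M (r * \<bar>u r\<bar>) * weight n r)
          \<le> root_bound D (D + real n - 2) (enn2real (calL M n u)) (enn2real (calM M n u))"
    unfolding T_def
  proof (rule truncated_hardy[OF M \<open>2 \<le> d\<close> \<open>2 < D\<close> \<open>1 \<le> n\<close> \<open>0 < R\<close> uR S u'(1)])
    show "continuous_on ({0<..<R} - S) (deriv u)" using u'_cont by (simp add: T_def)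
    show "set_integrable lborel ({0<..<R} - S) (\<lambda>r. M \<bar>deriv u r\<bar> * weight n r)"
      using grad_int by (simp add: T_def)
    show "(LINT r:{0<..<R} - S|lborel. M \<bar>u r\<bar> * weight n r) \<le> enn2real (calL M n u)"
      using le_whole[OF uT L_int] L by (simp add: T_def calL_def)
    show "(LINT r:{0<..<R} - S|lborel. M \<bar>deriv u r\<bar> * weight n r) \<le> enn2real (calM M n u)"
      using le_whole[OF u'_cont grad_int] Mf by (simp add: T_def calM_def)
  qed (simp add: T_def)
  then show ?thesis unfolding K by (auto intro: ennreal_leI)
qed

text \<open>Which alternative holds may depend on \<open>R\<close>, but the truncated integrals increase with \<open>R\<close>: once the first
  alternative fails it fails for all larger \<open>R\<close>, and then the second holds for all \<open>R\<close>.\<close>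

lemma calK_alternative:
  assumes M: "condition_M M d D" and "2 \<le> d" "2 < D" "1 \<le> n"
    and u: "piecewise_C1_halfline u"
    and L: "calL M n u < top" and Mf: "calM M n u < top"
  shows "calK M n u \<le> ennreal ((D / d) powr (D / (D - 2)) * enn2real (calL M n u))
    \<or> calK M n u \<le> ennreal (root_bound D (D + real n - 2) (enn2real (calL M n u)) (enn2real (calM M n u)))"
    (is "_ \<le> ?A \<or> _ \<le> ?B")
proof -
  define K where "K = (\<lambda>R. \<integral>\<^sup>+ r. ennreal (M (r * \<bar>u r\<bar>)) * indicator {..<R} r \<partial>mu n)"
  have alternative: "K R \<le> ?A \<or> K R \<le> ?B" if "0 < R" for R
    unfolding K_def by (rule calK_truncated_le[OF M \<open>2 \<le> d\<close> \<open>2 < D\<close> \<open>1 \<le> n\<close> that u L Mf])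
  have mono: "K R \<le> K R'" if "R \<le> R'" for R R'
    unfolding K_def using that by (intro nn_integral_mono) (auto simp: indicator_def)
  have "(\<lambda>r. M (r * \<bar>u r\<bar>)) \<in> borel_measurable (mu n)"
    using u by (intro borel_measurable_mu condition_M_continuous_on_compose[OF M])
      (auto simp: piecewise_C1_halfline_def)
  then have meas: "(\<lambda>r. ennreal (M (r * \<bar>u r\<bar>))) \<in> borel_measurable (mu n)" by measurable
  have limit: "calK M n u \<le> C" if "\<And>R. 0 < R \<Longrightarrow> K R \<le> C" for C
    unfolding calK_def using that by (intro nn_integral_mu_le_if_truncations_le[OF meas]) (simp add: K_def)
  show ?thesis
  proof (cases "\<forall>R>0. K R \<le> ?A")
    case True
    then show ?thesis using limit by blast
  next
    case False
    then obtain R0 where R0: "0 < R0" "\<not> K R0 \<le> ?A" by blast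
    have "K R \<le> ?B" if "0 < R" for R
    proof -
      have "\<not> K (max R R0) \<le> ?A"
        using R0 mono[of R0 "max R R0"] by (meson max.cobounded2 order_trans)
      then have "K (max R R0) \<le> ?B" using alternative[of "max R R0"] R0 by auto
      then show ?thesis using mono[of R "max R R0"] by (meson max.cobounded1 order_trans)
    qed
    then show ?thesis using limit by blast
  qed
qed

theorem proposition3p1:
  fixes M u :: "real \<Rightarrow> real" and d D :: real and n :: nat
  assumes "condition_M M d D"
    and "d \<ge> 2" and "D > 2"
    and "n \<ge> 1"
    and "piecewise_C1_halfline u"
  shows "((calK M n u \<le> ennreal ((D / d) powr (D / (D - 2))) * calL M n u \<and>
           ennreal ((D / d) powr (D / (D - 2))) * calL M n u \<le> ennreal (exp (D / 2)) * calL M n u)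
          \<or> calK M n u \<le> hardy_bound M D n u)
         \<and> (D + real n \<ge> exp 1 + 2 \<longrightarrow> calK M n u \<le> hardy_bound M D n u)
         \<and> (n \<ge> 3 \<longrightarrow> D + real n \<ge> exp 1 + 2)"
proof -
  let ?C = "(D / d) powr (D / (D - 2))" and ?l = "enn2real (calL M n u)" and ?m = "enn2real (calM M n u)"
  have C_le: "?C \<le> exp (D / 2)" using assms by (intro threshold_le_exp) auto
  have "(calK M n u \<le> ennreal ?C * calL M n u \<or> calK M n u \<le> hardy_bound M D n u) \<and>
      (exp 1 + 2 \<le> D + real n \<longrightarrow> calK M n u \<le> hardy_bound M D n u)"
  proof (cases "calM M n u = top \<or> calL M n u = top")
    case True
    then show ?thesis using hardy_bound_eq_top[OF True] assms by simp
  next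
    case False
    then have fin: "calM M n u < top" "calL M n u < top" by (auto simp: top.not_eq_extremum)
    have hb: "hardy_bound M D n u = ennreal (root_bound D (D + real n - 2) ?l ?m)"
      using fin assms by (intro hardy_bound_eq_root_bound) auto
    have C: "ennreal (?C * ?l) = ennreal ?C * calL M n u"
      using fin by (simp add: ennreal_mult)
    \<comment> \<open>When \<open>D + n - 2 \<ge> e\<close>, the \<open>L\<close>-term alone makes the root bound at least \<open>e\<^bsup>D/2\<^esup> L\<close>.\<close>
    have small: "?C * ?l \<le> root_bound D (D + real n - 2) ?l ?m" if "exp 1 + 2 \<le> D + real n"
    proof -
      have "exp (D / 2) = exp 1 powr (D / 2)" by (simp add: exp_powr_real)
      also have "\<dots> \<le> (D + real n - 2) powr (D / 2)"
        using that assms by (intro powr_mono2) auto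
      finally have "?C * ?l \<le> (D + real n - 2) powr (D / 2) * ?l"
        using C_le by (intro mult_right_mono) auto
      also have "\<dots> \<le> root_bound D (D + real n - 2) ?l ?m"
        using assms by (intro le_root_bound_middle) auto
      finally show ?thesis .
    qed
    show ?thesis
      using calK_alternative[OF assms fin(2,1)] order_trans[OF _ ennreal_leI[OF small]]
      unfolding hb C by blast
  qed
  moreover have "ennreal ?C * calL M n u \<le> ennreal (exp (D / 2)) * calL M n u"
    using C_le by (intro mult_right_mono ennreal_leI) auto
  moreover have "exp 1 + 2 \<le> D + real n" if "n \<ge> 3"
    using that \<open>D > 2\<close> exp_le by linarith
  ultimately show ?thesis by blast
qed

end
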